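(* Let $\{\boldsymbol w^{(k)}\}$, $\{p_{ij}^{(k)}\}$, $q^{(k)}$, $R^{(k)}$ be generated by {\sf m-d-Lawson} with Lawson exponent $\beta$, under conditions (A1) and (A2) of the context, and suppose $d(\boldsymbol w^{(k)})>0$. Then $$\sqrt{d(\boldsymbol w^{(k+1)})}\ \ge\ d(\boldsymbol w^{(k)})\,\frac{\big|(\boldsymbol q^{(k+1)})^{\mathrm H}W^{(k)}\boldsymbol q^{(k)}\big|}{\gamma_\beta^{(k)}\,\zeta_\beta^{(k)}},$$ where $W^{(k)}=\mathrm{diag}(\boldsymbol w^{(k)})$, $\boldsymbol q^{(k)}=[q^{(k)}(x_1),\dots,q^{(k)}(x_m)]^{\mathrm T}$, $\tau_\ell^{(k)}=\|F(x_\ell)-R^{(k)}(x_\ell)\|_{\mathrm F}$, $\gamma_\beta^{(k)}=\sum_{\ell=1}^m w_\ell^{(k)}(\tau_\ell^{(k)})^\beta$, and $$\zeta_\beta^{(k)}=\left(\sum_{\ell=1}^m w_\ell^{(k+1)}\sum_{i=1}^s\sum_{j=1}^t\left|\frac{f_{ij}(x_\ell)q^{(k)}(x_\ell)-p^{(k)}_{ij}(x_\ell)}{(\tau_\ell^{(k)})^\beta}\right|^2\right)^{1/2},$$ with the convention $0\cdot\frac00=0$.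
   Context: $s,t\ge1$ and $d,n_{ij}\ge0$ are given integers; $\mathbb P_n$ is the set of complex polynomials of degree at most $n$; $x_1,\dots,x_m\in\mathbb C$ are distinct nodes with $m\ge\max_{i,j}\{n_{ij}+d+2\}$; $F(x_\ell)=[f_{ij}(x_\ell)]\in\mathbb C^{s\times t}$ are given data; $\|\cdot\|_{\mathrm F}$ is the Frobenius norm. $\mathcal S=\{\boldsymbol w\in\mathbb R^m:\boldsymbol w\ge0,\sum_\ell w_\ell=1\}$, and $$d(\boldsymbol w)=\min\Big\{\sum_{\ell=1}^m w_\ell\sum_{i,j}|f_{ij}(x_\ell)q(x_\ell)-p_{ij}(x_\ell)|^2:\ p_{ij}\in\mathbb P_{n_{ij}},\ q\in\mathbb P_d,\ \sum_{\ell=1}^m w_\ell|q(x_\ell)|^2=1\Big\}.$$ Iteration {\sf m-d-Lawson} with Lawson exponent $\beta>0$: start from $\boldsymbol w^{(0)}\in\mathcal S$ with positive entries. At step $k$, let $(\{p^{(k)}_{ij}\},q^{(k)})$ attain the minimum $d(\boldsymbol w^{(k)})$, set $R^{(k)}=[p^{(k)}_{ij}/q^{(k)}]$, and update $$w_\ell^{(k+1)}=\frac{w_\ell^{(k)}\|F(x_\ell)-R^{(k)}(x_\ell)\|_{\mathrm F}^\beta}{\sum_{i=1}^m w_i^{(k)}\|F(x_i)-R^{(k)}(x_i)\|_{\mathrm F}^\beta},\quad 1\le\ell\le m.$$ Assumptions: (A1) $q^{(k)}(x_\ell)\ne0$ for all $1\le\ell\le m$ and all $k\ge0$. (A2) For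 all $k\ge0$, the number of indices $\ell$ with $w_\ell^{(k)}\ne0$ is at least $\max\{d+1,\max_{i,j}(n_{ij}+1)\}$. *)

theory Defs
  imports
    "HOL-Analysis.Analysis"
    "HOL-Computational_Algebra.Polynomial"
    "HOL-Library.Extended_Nat"
begin

text \<open>
  The finite types \<open>'m\<close>, \<open>'s\<close>, \<open>'t\<close> index the nodes, the rows and the columns, so
  \<open>m = CARD('m)\<close>, \<open>s = CARD('s) \<ge> 1\<close> and \<open>t = CARD('t) \<ge> 1\<close> are arbitrary.
  A tuple of numerators has type \<open>'s \<Rightarrow> 't \<Rightarrow> complex poly\<close>.
\<close>

text \<open>The library norm on \<open>complex^'t^'s\<close> is the Frobenius norm:\<close>

lemma norm_matrix_eq_frobenius:
  fixes A :: "complex^'t::finite^'s::finite"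
  shows "norm A = sqrt (\<Sum>i\<in>UNIV. \<Sum>j\<in>UNIV. (cmod (A $ i $ j))\<^sup>2)"
  by (simp add: norm_vec_def L2_set_def sum_nonneg)

definition polys_upto :: "nat \<Rightarrow> complex poly set" where
  "polys_upto n = {p. degree p \<le> n}"

definition prob_simplex :: "(real^'m::finite) set" where
  "prob_simplex = {w. (\<forall>l. 0 \<le> w $ l) \<and> (\<Sum>l\<in>UNIV. w $ l) = 1}"

definition lawson_feasible ::
  "('m::finite \<Rightarrow> complex) \<Rightarrow> ('s \<Rightarrow> 't \<Rightarrow> nat) \<Rightarrow> nat \<Rightarrow> real^'m
    \<Rightarrow> ('s \<Rightarrow> 't \<Rightarrow> complex poly) \<times> complex poly \<Rightarrow> bool" where
  "lawson_feasible x n d w = (\<lambda>(p, q).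
     (\<forall>i j. p i j \<in> polys_upto (n i j)) \<and> q \<in> polys_upto d \<and>
     (\<Sum>l\<in>UNIV. w $ l * (cmod (poly q (x l)))\<^sup>2) = 1)"

definition lawson_objective ::
  "('m::finite \<Rightarrow> complex) \<Rightarrow> (complex \<Rightarrow> complex^'t::finite^'s::finite) \<Rightarrow> real^'m
    \<Rightarrow> ('s \<Rightarrow> 't \<Rightarrow> complex poly) \<times> complex poly \<Rightarrow> real" where
  "lawson_objective x F w = (\<lambda>(p, q).
     \<Sum>l\<in>UNIV. w $ l * (\<Sum>i\<in>UNIV. \<Sum>j\<in>UNIV.
       (cmod (F (x l) $ i $ j * poly q (x l) - poly (p i j) (x l)))\<^sup>2))"

text \<open>
  \<open>d(w)\<close> is a minimum rather than an infimum, hence \<open>LEAST\<close>: it is the smallest element of the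
  set of values whenever that exists, and unspecified otherwise.
\<close>

definition dual_value ::
  "('m::finite \<Rightarrow> complex) \<Rightarrow> (complex \<Rightarrow> complex^'t::finite^'s::finite)
    \<Rightarrow> ('s \<Rightarrow> 't \<Rightarrow> nat) \<Rightarrow> nat \<Rightarrow> real^'m \<Rightarrow> real" where
  "dual_value x F n d w =
     (LEAST v. v \<in> lawson_objective x F w ` {pq. lawson_feasible x n d w pq})"

definition rational_matrix ::
  "('s::finite \<Rightarrow> 't::finite \<Rightarrow> complex poly) \<Rightarrow> complex poly \<Rightarrow> complex \<Rightarrow> complex^'t^'s" where
  "rational_matrix p q z = (\<chi> i j. poly (p i j) z / poly q z)"

definition lawson_tau ::
  "('m::finite \<Rightarrow> complex) \<Rightarrow> (complex \<Rightarrow> complex^'t::finite^'s::finite)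
    \<Rightarrow> ('s \<Rightarrow> 't \<Rightarrow> complex poly) \<Rightarrow> complex poly \<Rightarrow> 'm \<Rightarrow> real" where
  "lawson_tau x F p q l = norm (F (x l) - rational_matrix p q (x l))"

text \<open>Note that \<open>0 powr \<beta> = 0\<close>, as required for \<open>\<beta> > 0\<close>.\<close>

definition lawson_gamma ::
  "('m::finite \<Rightarrow> complex) \<Rightarrow> (complex \<Rightarrow> complex^'t::finite^'s::finite) \<Rightarrow> real
    \<Rightarrow> real^'m \<Rightarrow> ('s \<Rightarrow> 't \<Rightarrow> complex poly) \<Rightarrow> complex poly \<Rightarrow> real" where
  "lawson_gamma x F \<beta> w p q = (\<Sum>l\<in>UNIV. w $ l * lawson_tau x F p q l powr \<beta>)"

text \<open>
  In \<open>\<zeta>\<close> the argument \<open>w'\<close> is the updated weight vector, while \<open>p\<close>, \<open>q\<close> belong to the previous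
  step. The convention \<open>0 \<cdot> 0/0 = 0\<close> is built into division: \<open>a / 0 = 0\<close>.
\<close>

definition lawson_zeta ::
  "('m::finite \<Rightarrow> complex) \<Rightarrow> (complex \<Rightarrow> complex^'t::finite^'s::finite) \<Rightarrow> real
    \<Rightarrow> real^'m \<Rightarrow> ('s \<Rightarrow> 't \<Rightarrow> complex poly) \<Rightarrow> complex poly \<Rightarrow> real" where
  "lawson_zeta x F \<beta> w' p q =
     sqrt (\<Sum>l\<in>UNIV. w' $ l * (\<Sum>i\<in>UNIV. \<Sum>j\<in>UNIV.
       (cmod ((F (x l) $ i $ j * poly q (x l) - poly (p i j) (x l)) /
              complex_of_real (lawson_tau x F p q l powr \<beta>)))\<^sup>2))"

text \<open>
  \<open>N\<close> is the index of the last iterate, so that besides infinite runs (\<open>N = \<infinity>\<close>) also runs that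
  stop are covered: if \<open>d(w\<^sup>(\<^sup>k\<^sup>)) = 0\<close>, the denominator of the update vanishes and no further
  iterate exists.
\<close>

definition md_lawson ::
  "('m::finite \<Rightarrow> complex) \<Rightarrow> (complex \<Rightarrow> complex^'t::finite^'s::finite)
    \<Rightarrow> ('s \<Rightarrow> 't \<Rightarrow> nat) \<Rightarrow> nat \<Rightarrow> real \<Rightarrow> enat
    \<Rightarrow> (nat \<Rightarrow> real^'m) \<Rightarrow> (nat \<Rightarrow> 's \<Rightarrow> 't \<Rightarrow> complex poly) \<Rightarrow> (nat \<Rightarrow> complex poly) \<Rightarrow> bool" where
  "md_lawson x F n d \<beta> N w p q \<longleftrightarrow>
     w 0 \<in> prob_simplex \<and> (\<forall>l. 0 < w 0 $ l) \<and>
     (\<forall>k. enat k \<le> N \<longrightarrow>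
        is_arg_min (lawson_objective x F (w k)) (lawson_feasible x n d (w k)) (p k, q k)) \<and>
     (\<forall>k. enat (Suc k) \<le> N \<longrightarrow>
        (\<forall>l. w (Suc k) $ l =
           w k $ l * norm (F (x l) - rational_matrix (p k) (q k) (x l)) powr \<beta> /
           (\<Sum>i\<in>UNIV. w k $ i * norm (F (x i) - rational_matrix (p k) (q k) (x i)) powr \<beta>)))"

definition diag_matrix :: "real^'m::finite \<Rightarrow> complex^'m^'m" where
  "diag_matrix w = (\<chi> a b. if a = b then complex_of_real (w $ a) else 0)"

definition node_values :: "('m::finite \<Rightarrow> complex) \<Rightarrow> complex poly \<Rightarrow> complex^'m" where
  "node_values x q = (\<chi> l. poly q (x l))"

text \<open>The product of the conjugate transpose of \<open>u\<close> with \<open>v\<close>.\<close>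

definition herm_prod :: "complex^'m::finite \<Rightarrow> complex^'m \<Rightarrow> complex" where
  "herm_prod u v = (\<Sum>l\<in>UNIV. cnj (u $ l) * v $ l)"

end

theory Submission imports Defs begin

text \<open>
  By scaling, a minimizer \<open>v = (p, q)\<close> of the constrained problem makes the Hermitian form
  \<open>objective - d(w) \<cdot> constraint\<close> positive semidefinite and is a null vector of it, so its polar
  form vanishes at \<open>(v, u)\<close> for every \<open>u\<close>. Taking for \<open>u\<close> the minimizer of the next step expresses
  \<open>d(w)\<close> times the Hermitian product of the theorem as a weighted product of the two
  residuals; replacing \<open>w\<^sub>l\<close> by \<open>\<gamma> w'\<^sub>l / \<tau>\<^sub>l\<^sup>\<beta>\<close>, the Cauchy-Schwarz inequality with weights \<open>w'\<close> gives
  the bound.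
\<close>

text \<open>Clearing the denominator makes the error complex-linear in the pair
  \<open>(p, q)\<close>; this is why the objective is a Hermitian form.\<close>

definition residual ::
  "('m \<Rightarrow> complex) \<Rightarrow> (complex \<Rightarrow> complex^'t::finite^'s::finite)
    \<Rightarrow> ('s \<Rightarrow> 't \<Rightarrow> complex poly) \<Rightarrow> complex poly \<Rightarrow> 'm \<Rightarrow> 's \<Rightarrow> 't \<Rightarrow> complex" where
  "residual x F p q l i j = F (x l) $ i $ j * poly q (x l) - poly (p i j) (x l)"

lemma lawson_objective_eq_residual:
  "lawson_objective x F w (p, q) =
     (\<Sum>l\<in>UNIV. w $ l * (\<Sum>i\<in>UNIV. \<Sum>j\<in>UNIV. (cmod (residual x F p q l i j))\<^sup>2))"
  by (simp add: lawson_objective_def residual_def)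

lemma residual_add_smult:
  "residual x F (\<lambda>i j. p i j + smult c (p' i j)) (q + smult c q') l i j =
     residual x F p q l i j + c * residual x F p' q' l i j"
  by (simp add: residual_def algebra_simps)

lemma residual_smult:
  "residual x F (\<lambda>i j. smult c (p i j)) (smult c q) l i j = c * residual x F p q l i j"
  by (simp add: residual_def algebra_simps)

lemma lawson_objective_nonneg:
  assumes "\<And>l. 0 \<le> w $ l"
  shows "0 \<le> lawson_objective x F w pq"
  using assms by (cases pq) (simp add: lawson_objective_eq_residual sum_nonneg)

text \<open>An attained minimum is what makes the \<open>LEAST\<close> in \<open>dual_value\<close>
  specified.\<close>

lemma dual_value_eq:
  assumes "is_arg_min (lawson_objective x F w) (lawson_feasible x n d w) pq"
  shows "dual_value x F n d w = lawson_objective x F w pq"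
  unfolding dual_value_def
  by (rule Least_equality) (use assms in \<open>auto simp: is_arg_min_linorder\<close>)

text \<open>The cross term has \<open>cnj c\<close> pulled out in front, the shape that
  \<open>polar_eq_zero\<close> expects.\<close>

lemma cmod_add_mult_power2:
  "(cmod (a + c * b))\<^sup>2 = (cmod a)\<^sup>2 + 2 * Re (cnj c * (cnj b * a)) + (cmod c)\<^sup>2 * (cmod b)\<^sup>2"
  unfolding cmod_power2 by (simp add: power2_eq_square algebra_simps)

text \<open>For small \<open>c\<close> the linear term dominates the quadratic one, and choosing
  \<open>c\<close> as a negative multiple of \<open>h\<close> makes it negative unless
  \<open>h = 0\<close>.\<close>

lemma polar_eq_zero:
  fixes h :: complex and a :: real
  assumes "\<And>c. 0 \<le> 2 * Re (cnj c * h) + (cmod c)\<^sup>2 * a"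
  shows "h = 0"
proof (rule ccontr)
  assume "h \<noteq> 0"
  \<comment> \<open>Small enough for \<open>t * a < 2\<close> whatever the sign of \<open>a\<close>,
    and defined also for \<open>a = 0\<close>.\<close>
  define t where "t = 1 / (1 + \<bar>a\<bar>)"
  have t: "t > 0" "t * a < 2"
    by (auto simp: t_def field_simps abs_if)
  have "Re (cnj (- of_real t * h) * h) = - (t * (cmod h)\<^sup>2)"
    unfolding cmod_power2 by (simp add: algebra_simps power2_eq_square)
  then have "0 \<le> 2 * (- (t * (cmod h)\<^sup>2)) + t\<^sup>2 * (cmod h)\<^sup>2 * a"
    using assms[of "- of_real t * h"] t(1)
    by (simp only: norm_mult norm_minus_cancel norm_of_real power_mult_distrib power2_abs)
  also have "\<dots> = (t * (cmod h)\<^sup>2) * (t * a - 2)"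
    by (simp add: algebra_simps power2_eq_square)
  also have "\<dots> < 0"
    using t \<open>h \<noteq> 0\<close> by (intro mult_pos_neg) auto
  finally show False by simp
qed

text \<open>This is Cauchy-Schwarz on the set of all triples \<open>(l, i, j)\<close>, with the
  weight split as \<open>sqrt (w l) * sqrt (w l)\<close> between the two factors.\<close>

lemma cmod_weighted_sum_le:
  fixes w :: "'m::finite \<Rightarrow> real" and u v :: "'m \<Rightarrow> 's::finite \<Rightarrow> 't::finite \<Rightarrow> complex"
  assumes "\<And>l. 0 \<le> w l"
  shows "cmod (\<Sum>l\<in>UNIV. of_real (w l) * (\<Sum>i\<in>UNIV. \<Sum>j\<in>UNIV. cnj (u l i j) * v l i j))
    \<le> sqrt (\<Sum>l\<in>UNIV. w l * (\<Sum>i\<in>UNIV. \<Sum>j\<in>UNIV. (cmod (u l i j))\<^sup>2)) *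
      sqrt (\<Sum>l\<in>UNIV. w l * (\<Sum>i\<in>UNIV. \<Sum>j\<in>UNIV. (cmod (v l i j))\<^sup>2))"
proof -
  define U where "U = (\<lambda>(l, i, j). sqrt (w l) * cmod (u l i j))"
  define V where "V = (\<lambda>(l, i, j). sqrt (w l) * cmod (v l i j))"
  have triple: "(\<Sum>l\<in>UNIV. \<Sum>i\<in>UNIV. \<Sum>j\<in>UNIV. g l i j) = (\<Sum>(l, i, j)\<in>UNIV. g l i j)"
    for g :: "'m \<Rightarrow> 's \<Rightarrow> 't \<Rightarrow> 'b::comm_monoid_add"
    by (simp add: sum.cartesian_product)
  have "cmod (\<Sum>l\<in>UNIV. of_real (w l) * (\<Sum>i\<in>UNIV. \<Sum>j\<in>UNIV. cnj (u l i j) * v l i j))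
      = cmod (\<Sum>(l, i, j)\<in>UNIV. of_real (w l) * (cnj (u l i j) * v l i j))"
    by (simp add: sum_distrib_left triple)
  also have "\<dots> \<le> (\<Sum>z\<in>UNIV. \<bar>U z\<bar> * \<bar>V z\<bar>)"
  proof (rule sum_norm_le)
    have eq: "cmod (of_real (w l) * (cnj (u l i j) * v l i j))
        = (sqrt (w l) * cmod (u l i j)) * (sqrt (w l) * cmod (v l i j))" for l i j
    proof -
      have "cmod (of_real (w l) * (cnj (u l i j) * v l i j))
          = (sqrt (w l) * sqrt (w l)) * (cmod (u l i j) * cmod (v l i j))"
        using assms by (simp add: norm_mult)
      then show ?thesis by (simp only: ac_simps)
    qed
    show "cmod (case z of (l, i, j) \<Rightarrow> of_real (w l) * (cnj (u l i j) * v l i j))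
        \<le> \<bar>U z\<bar> * \<bar>V z\<bar>" for z
      by (cases z) (simp only: U_def V_def prod.case eq abs_of_nonneg mult_nonneg_nonneg
          real_sqrt_ge_zero assms norm_ge_zero order_refl)
  qed
  also have "\<dots> \<le> L2_set U UNIV * L2_set V UNIV"
    by (rule L2_set_mult_ineq)
  also have "L2_set U UNIV = sqrt (\<Sum>l\<in>UNIV. w l * (\<Sum>i\<in>UNIV. \<Sum>j\<in>UNIV. (cmod (u l i j))\<^sup>2))"
    using assms
    by (simp add: L2_set_def U_def sum_distrib_left triple power_mult_distrib case_prod_unfold)
  also have "L2_set V UNIV = sqrt (\<Sum>l\<in>UNIV. w l * (\<Sum>i\<in>UNIV. \<Sum>j\<in>UNIV. (cmod (v l i j))\<^sup>2))"
    using assms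
    by (simp add: L2_set_def V_def sum_distrib_left triple power_mult_distrib case_prod_unfold)
  finally show ?thesis .
qed

text \<open>Objective and constraint are both homogeneous of degree 2, so the bound known on
  normalized pairs extends to every pair within the degree bounds.\<close>

lemma arg_min_mult_le_lawson_objective:
  assumes min: "is_arg_min (lawson_objective x F w) (lawson_feasible x n d w) v"
    and w: "\<And>l. 0 \<le> w $ l"
    and deg: "\<And>i j. degree (p i j) \<le> n i j" "degree q \<le> d"
  shows "lawson_objective x F w v * (\<Sum>l\<in>UNIV. w $ l * (cmod (poly q (x l)))\<^sup>2)
    \<le> lawson_objective x F w (p, q)"
proof -
  define M where "M = (\<Sum>l\<in>UNIV. w $ l * (cmod (poly q (x l)))\<^sup>2)"
  have "M \<ge> 0"
    unfolding M_def using w by (intro sum_nonneg) auto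
  show ?thesis
  proof (cases "M = 0")
    \<comment> \<open>Such a pair cannot be normalized, but then the left side is 0 and the
      objective is nonnegative.\<close>
    case True
    then show ?thesis
      using lawson_objective_nonneg[OF w] by (simp add: M_def)
  next
    case False
    with \<open>M \<ge> 0\<close> have "M > 0" by simp
    define c where "c = complex_of_real (1 / sqrt M)"
    have c: "(cmod c)\<^sup>2 = 1 / M"
      using \<open>M > 0\<close> by (simp add: c_def norm_divide power_divide)
    have scale: "(\<Sum>l\<in>UNIV. w $ l * ((cmod c)\<^sup>2 * g l)) = (\<Sum>l\<in>UNIV. w $ l * g l) / M"
      for g :: "_ \<Rightarrow> real"
      unfolding c by (simp add: sum_divide_distrib)
    have "lawson_feasible x n d w (\<lambda>i j. smult c (p i j), smult c q)"
      using deg \<open>M > 0\<close> order_trans[OF degree_smult_le]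
      by (auto simp: lawson_feasible_def polys_upto_def norm_mult power_mult_distrib scale
          simp flip: M_def)
    then have "lawson_objective x F w v
        \<le> lawson_objective x F w (\<lambda>i j. smult c (p i j), smult c q)"
      using min by (simp add: is_arg_min_linorder)
    also have "\<dots> = lawson_objective x F w (p, q) / M"
      by (simp add: lawson_objective_eq_residual residual_smult norm_mult power_mult_distrib
          scale flip: sum_distrib_left)
    finally show ?thesis
      using \<open>M > 0\<close> by (simp add: M_def[symmetric] field_simps)
  qed
qed

text \<open>The homogeneous bound is applied to the minimizer moved by \<open>c\<close> times
  \<open>(p', q')\<close>, for every complex \<open>c\<close>. The direction is restricted by
  degrees only, so it may be the next iterate, which is normalized for other weights.\<close>

lemma lawson_stationarity:
  assumes min: "is_arg_min (lawson_objective x F w) (lawson_feasible x n d w) (p, q)"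
    and w: "\<And>l. 0 \<le> w $ l"
    and deg: "\<And>i j. degree (p' i j) \<le> n i j" "degree q' \<le> d"
  shows "(\<Sum>l\<in>UNIV. of_real (w $ l) *
        (\<Sum>i\<in>UNIV. \<Sum>j\<in>UNIV. cnj (residual x F p' q' l i j) * residual x F p q l i j))
    = of_real (lawson_objective x F w (p, q)) *
        (\<Sum>l\<in>UNIV. of_real (w $ l) * (cnj (poly q' (x l)) * poly q (x l)))"
    (is "?A = of_real ?D * ?B")
proof -
  define M where "M = (\<Sum>l\<in>UNIV. w $ l * (cmod (poly q' (x l)))\<^sup>2)"
  have feas: "lawson_feasible x n d w (p, q)"
    using min by (simp add: is_arg_min_linorder)
  \<comment> \<open>Expanding both sides in \<open>c\<close>, the constant terms cancel: each equals
    \<open>?D\<close>, because the minimizer satisfies the constraint with value 1.\<close>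
  have "0 \<le> 2 * Re (cnj c * (?A - of_real ?D * ?B))
      + (cmod c)\<^sup>2 * (lawson_objective x F w (p', q') - ?D * M)" for c
  proof -
    have "degree (p i j + smult c (p' i j)) \<le> n i j" for i j
      using feas deg(1)[of i j]
      by (auto simp: lawson_feasible_def polys_upto_def
          intro!: degree_add_le order_trans[OF degree_smult_le])
    moreover have "degree (q + smult c q') \<le> d"
      using feas deg(2)
      by (auto simp: lawson_feasible_def polys_upto_def
          intro!: degree_add_le order_trans[OF degree_smult_le])
    ultimately have "?D * (\<Sum>l\<in>UNIV. w $ l * (cmod (poly (q + smult c q') (x l)))\<^sup>2)
        \<le> lawson_objective x F w (\<lambda>i j. p i j + smult c (p' i j), q + smult c q')"
      by (intro arg_min_mult_le_lawson_objective[OF min w])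
    moreover have "(\<Sum>l\<in>UNIV. w $ l * (cmod (poly (q + smult c q') (x l)))\<^sup>2)
        = 1 + 2 * Re (cnj c * ?B) + (cmod c)\<^sup>2 * M"
    proof -
      have "(\<Sum>l\<in>UNIV. w $ l * (cmod (poly (q + smult c q') (x l)))\<^sup>2)
          = (\<Sum>l\<in>UNIV. w $ l * (cmod (poly q (x l)))\<^sup>2
              + 2 * Re (cnj c * (of_real (w $ l) * (cnj (poly q' (x l)) * poly q (x l))))
              + (cmod c)\<^sup>2 * (w $ l * (cmod (poly q' (x l)))\<^sup>2))"
        by (intro sum.cong refl) (simp add: cmod_add_mult_power2 algebra_simps)
      also have "\<dots> = 1 + 2 * Re (cnj c * ?B) + (cmod c)\<^sup>2 * M"
        using feas
        by (simp only: sum.distrib sum_distrib_left Re_sum M_def lawson_feasible_def prod.case)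
      finally show ?thesis .
    qed
    moreover have "lawson_objective x F w (\<lambda>i j. p i j + smult c (p' i j), q + smult c q')
        = ?D + 2 * Re (cnj c * ?A) + (cmod c)\<^sup>2 * lawson_objective x F w (p', q')"
      unfolding lawson_objective_eq_residual residual_add_smult cmod_add_mult_power2
        sum_distrib_left Re_sum sum.distrib[symmetric]
      by (intro sum.cong refl) (simp add: algebra_simps)
    ultimately show ?thesis
      by (simp add: algebra_simps)
  qed
  then have "?A - of_real ?D * ?B = 0"
    by (rule polar_eq_zero)
  then show ?thesis by simp
qed

text \<open>This links the linearized residual to the true error, so that
  \<open>\<tau> l = 0\<close> forces all residuals at the node \<open>l\<close> to vanish.\<close>

lemma residual_eq_mult:
  assumes "poly q (x l) \<noteq> 0"
  shows "residual x F p q l i j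
    = poly q (x l) * (F (x l) - rational_matrix p q (x l)) $ i $ j"
  using assms by (simp add: residual_def rational_matrix_def algebra_simps)

lemma md_lawson_weights_nonneg:
  assumes "md_lawson x F n d \<beta> N w p q" "enat r \<le> N"
  shows "0 \<le> w r $ l"
  using assms(2)
proof (induction r arbitrary: l)
  case 0
  then show ?case
    using assms(1) by (simp add: md_lawson_def less_imp_le)
next
  case (Suc r)
  then have "enat r \<le> N"
    using order_trans[of "enat r" "enat (Suc r)" N] by simp
  with Suc assms(1) show ?case
    by (auto simp: md_lawson_def intro!: divide_nonneg_nonneg sum_nonneg mult_nonneg_nonneg)
qed

lemma herm_prod_diag_matrix:
  "herm_prod u (diag_matrix w *v v) = (\<Sum>l\<in>UNIV. of_real (w $ l) * (cnj (u $ l) * v $ l))"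
proof -
  have "(diag_matrix w *v v) $ l = of_real (w $ l) * v $ l" for l
    by (simp add: diag_matrix_def matrix_vector_mult_def if_distrib[of "\<lambda>z. z * _"] cong: if_cong)
  then show ?thesis
    by (simp add: herm_prod_def ac_simps)
qed

theorem theorem7p1:
  fixes x :: "'m::finite \<Rightarrow> complex"
    and F :: "complex \<Rightarrow> complex^'t::finite^'s::finite"
    and n :: "'s \<Rightarrow> 't \<Rightarrow> nat" and d :: nat
    and \<beta> :: real and N :: enat and k :: nat
    and w :: "nat \<Rightarrow> real^'m"
    and p :: "nat \<Rightarrow> 's \<Rightarrow> 't \<Rightarrow> complex poly"
    and q :: "nat \<Rightarrow> complex poly"
  assumes nodes: "inj x"
    and num_nodes: "CARD('m) \<ge> (MAX (i, j)\<in>UNIV. n i j + d + 2)"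
    and beta: "\<beta> > 0"
    and run: "md_lawson x F n d \<beta> N w p q"
    and A1: "\<And>r l. enat r \<le> N \<Longrightarrow> poly (q r) (x l) \<noteq> 0"
    and A2: "\<And>r. enat r \<le> N \<Longrightarrow>
      card {l. w r $ l \<noteq> 0} \<ge> max (d + 1) (MAX (i, j)\<in>UNIV. n i j + 1)"
    and k: "enat (Suc k) \<le> N"
    and pos: "dual_value x F n d (w k) > 0"
  shows "sqrt (dual_value x F n d (w (Suc k))) \<ge>
    dual_value x F n d (w k) *
      (cmod (herm_prod (node_values x (q (Suc k)))
              (diag_matrix (w k) *v node_values x (q k))) /
       (lawson_gamma x F \<beta> (w k) (p k) (q k) *
        lawson_zeta x F \<beta> (w (Suc k)) (p k) (q k)))"
proof -
  define D where "D = dual_value x F n d (w k)"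
  define \<gamma> where "\<gamma> = lawson_gamma x F \<beta> (w k) (p k) (q k)"
  define \<zeta> where "\<zeta> = lawson_zeta x F \<beta> (w (Suc k)) (p k) (q k)"
  define \<tau> where "\<tau> = lawson_tau x F (p k) (q k)"
  define e where "e = residual x F (p k) (q k)"
  define e' where "e' = residual x F (p (Suc k)) (q (Suc k))"
  define H where "H = herm_prod (node_values x (q (Suc k)))
    (diag_matrix (w k) *v node_values x (q k))"
  have k0: "enat k \<le> N"
    using k order_trans[of "enat k" "enat (Suc k)" N] by simp
  note w_nonneg = md_lawson_weights_nonneg[OF run k0] md_lawson_weights_nonneg[OF run k]
  have min: "is_arg_min (lawson_objective x F (w r)) (lawson_feasible x n d (w r)) (p r, q r)"
    if "enat r \<le> N" for r
    using run that by (simp add: md_lawson_def)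
  have D: "D = lawson_objective x F (w k) (p k, q k)"
    unfolding D_def by (rule dual_value_eq[OF min[OF k0]])
  have D': "dual_value x F n d (w (Suc k))
      = lawson_objective x F (w (Suc k)) (p (Suc k), q (Suc k))"
    by (rule dual_value_eq[OF min[OF k]])
  have "\<gamma> \<ge> 0"
    unfolding \<gamma>_def lawson_gamma_def by (intro sum_nonneg mult_nonneg_nonneg w_nonneg) auto
  have "\<zeta> \<ge> 0"
    unfolding \<zeta>_def lawson_zeta_def
    by (intro real_sqrt_ge_zero sum_nonneg mult_nonneg_nonneg w_nonneg) auto
  have update: "w (Suc k) $ l = w k $ l * \<tau> l powr \<beta> / \<gamma>" for l
    using run k by (simp add: md_lawson_def \<gamma>_def lawson_gamma_def \<tau>_def lawson_tau_def)
  show ?thesis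
  proof (cases "\<gamma> * \<zeta> = 0")
    \<comment> \<open>Division by zero gives 0, so the right side is 0 and only the nonnegativity of
      the root remains.\<close>
    case True
    then show ?thesis
      using lawson_objective_nonneg[OF w_nonneg(2)] by (auto simp: \<gamma>_def \<zeta>_def D')
  next
    case False
    with \<open>\<gamma> \<ge> 0\<close> \<open>\<zeta> \<ge> 0\<close> have pos: "\<gamma> > 0" "\<zeta> > 0" by auto
    \<comment> \<open>Where \<open>\<tau> l\<close> is nonzero, this is the update solved for the
      old weight. Where it is 0, the new weight no longer determines the old one, but by (A1) the
      residual vanishes and both sides are 0.\<close>
    have reweight: "of_real (w k $ l) * e l i j
        = of_real \<gamma> * (of_real (w (Suc k) $ l) * (e l i j / of_real (\<tau> l powr \<beta>)))" for l i j
    proof (cases "\<tau> l = 0")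
      case True
      then have "e l i j = 0"
        using residual_eq_mult[of "q k" x l F "p k" i j] A1[OF k0, of l]
        by (simp add: e_def \<tau>_def lawson_tau_def)
      then show ?thesis by simp
    next
      case False
      then show ?thesis
        using pos(1) by (simp add: update)
    qed
    have deg: "degree (p (Suc k) i j) \<le> n i j" "degree (q (Suc k)) \<le> d" for i j
      using min[OF k] by (auto simp: is_arg_min_linorder lawson_feasible_def polys_upto_def)
    \<comment> \<open>Dividing only \<open>e\<close> by \<open>\<tau> l powr \<beta>\<close> leaves
      \<open>e'\<close> intact, so the two Cauchy-Schwarz factors become the root of the new dual
      value and \<open>\<zeta>\<close>.\<close>
    define S where "S = (\<Sum>l\<in>UNIV. of_real (w (Suc k) $ l) *
        (\<Sum>i\<in>UNIV. \<Sum>j\<in>UNIV. cnj (e' l i j) * (e l i j / of_real (\<tau> l powr \<beta>))))"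
    have "of_real D * H = (\<Sum>l\<in>UNIV. of_real (w k $ l) *
        (\<Sum>i\<in>UNIV. \<Sum>j\<in>UNIV. cnj (e' l i j) * e l i j))"
      using lawson_stationarity[OF min[OF k0] w_nonneg(1) deg]
      by (simp add: H_def herm_prod_diag_matrix node_values_def D e_def e'_def)
    also have "\<dots> = of_real \<gamma> * S"
      unfolding sum_distrib_left S_def
      by (intro sum.cong refl) (simp only: mult.left_commute[of _ "cnj _"] reweight)
    finally have "cmod (of_real D * H) = cmod (of_real \<gamma> * S)" by simp
    then have "D * cmod H = \<gamma> * cmod S"
      using \<open>dual_value x F n d (w k) > 0\<close> pos(1) by (simp add: norm_mult D_def)
    \<comment> \<open>The first factor is the objective of iterate \<open>Suc k\<close> under its
      own weights, hence the new dual value by \<open>D'\<close>.\<close>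
    also have "cmod S \<le> sqrt (dual_value x F n d (w (Suc k))) * \<zeta>"
      using cmod_weighted_sum_le[of "\<lambda>l. w (Suc k) $ l" e' "\<lambda>l i j. e l i j / of_real (\<tau> l powr \<beta>)",
          OF w_nonneg(2)]
      by (simp only: S_def D' lawson_objective_eq_residual \<zeta>_def lawson_zeta_def e_def e'_def \<tau>_def
          residual_def)
    finally have "D * cmod H \<le> \<gamma> * (sqrt (dual_value x F n d (w (Suc k))) * \<zeta>)"
      using pos(1) by simp
    then show ?thesis
      using pos by (simp add: field_simps flip: D_def H_def \<gamma>_def \<zeta>_def)
  qed
qed

end
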